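(* Let $G=(V,w,m)$ be a graph, $x_0\in V$ and $f:=d(x_0,\cdot)$. Then $$\Delta f\le\Phi(f)$$ pointwise on $V$, with $$\Phi(R):=\mathrm{Deg}(x_0)-\sum_{r=1}^R\kappa(r)$$ for $R\ge1$ and $\Phi(0)=\mathrm{Deg}(x_0)$. The inequality is sharp for birth-death chains with $x_0=0$ (so that $f(r)=d(0,r)=r$), i.e. in that case $\Delta f=\Phi(f)$.
   Context: A graph is a triple $G=(V,w,m)$ with $V$ a countable set, $w:V\times V\to[0,\infty)$ symmetric and zero on the diagonal, and $m:V\to(0,\infty)$. Write $x\sim y$ if $w(x,y)>0$. All graphs are locally finite (for each $x$ only finitely many $y$ satisfy $x\sim y$) and connected; $d(x,y)=\inf\{n: x=x_0\sim\cdots\sim x_n=y\}$ is the combinatorial distance, which is finite by connectedness. A birth-death chain is a graph $(\mathbb N_0,w,m)$ with $w(k,n)=0$ whenever $|k-n|\neq1$. The Laplacian is $\Delta f(x)=\frac1{m(x)}\sum_{y\in V}w(x,y)(f(y)-f(x))$, and $\mathrm{Deg}(x)=\frac1{m(x)}\sum_{y}w(x,y)$. $Lip(1)$ is the set of $f:V\to\mathbb R$ with $|f(x)-f(y)|\le d(x,y)$ for all $x,y$. Curvature: for $x\in V$ and $\varepsilon>0$ let $m_x^\varepsilon(x)=1-\varepsilon\,\mathrm{Deg}(x)$ and $m_x^\varepsilon(y)=\varepsilon w(x,y)/m(x)$ for $y\neq x$; this is a finitely supported probability measure for $\varepsilon$ small. For probability measures $\mu,\nu$ on $V$, $W(\mu,\nu)=\sup_{f}\sum_{x}f(x)(\mu(x)-\nu(x))$,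 the supremum over bounded $f\in Lip(1)$. For $x\neq y$ let $\kappa_\varepsilon(x,y)=1-\frac{W(m_x^\varepsilon,m_y^\varepsilon)}{d(x,y)}$ and $\kappa(x,y)=\lim_{\varepsilon\to0^+}\frac1\varepsilon\kappa_\varepsilon(x,y)$ (this limit exists). Sphere curvatures with respect to $x_0$: with $S_r=\{y: d(x_0,y)=r\}$, for $r\ge1$ with $S_r\neq\emptyset$, $\kappa(r)=\min_{y\in S_r}\max_{x\in S_{r-1},\,x\sim y}\kappa(x,y)$. (The inequality at a vertex $x\in S_R$ involves only $\kappa(r)$ with $r\le R$, for which $S_r\ne\emptyset$.) *)

theory Defs
  imports "HOL-Analysis.Analysis"
begin

definition adj :: "'a set \<Rightarrow> ('a \<Rightarrow> 'a \<Rightarrow> real) \<Rightarrow> 'a rel" where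
  "adj V w = {(x, y). x \<in> V \<and> y \<in> V \<and> w x y > 0}"

text \<open>Only the values of \<open>w\<close> on \<open>V \<times> V\<close> and of \<open>m\<close> on \<open>V\<close> matter. Local finiteness and
  connectedness are standing assumptions on all graphs.\<close>

locale weighted_graph =
  fixes V :: "'a set" and w :: "'a \<Rightarrow> 'a \<Rightarrow> real" and m :: "'a \<Rightarrow> real"
  assumes countable_V: "countable V"
    and w_nonneg: "x \<in> V \<Longrightarrow> y \<in> V \<Longrightarrow> w x y \<ge> 0"
    and w_sym: "x \<in> V \<Longrightarrow> y \<in> V \<Longrightarrow> w x y = w y x"
    and w_diag: "x \<in> V \<Longrightarrow> w x x = 0"
    and m_pos: "x \<in> V \<Longrightarrow> m x > 0"
    and locally_finite: "x \<in> V \<Longrightarrow> finite {y \<in> V. w x y > 0}"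
    and connected: "x \<in> V \<Longrightarrow> y \<in> V \<Longrightarrow> (x, y) \<in> (adj V w)\<^sup>*"
begin

text \<open>The infinite sums below have only finitely many nonzero terms, by local finiteness.\<close>

definition gdist :: "'a \<Rightarrow> 'a \<Rightarrow> nat" where
  "gdist x y = Inf {n. (x, y) \<in> adj V w ^^ n}"

definition laplacian :: "('a \<Rightarrow> real) \<Rightarrow> 'a \<Rightarrow> real" where
  "laplacian f x = 1 / m x * (\<Sum>\<^sub>\<infinity>y\<in>V. w x y * (f y - f x))"

definition Deg :: "'a \<Rightarrow> real" where
  "Deg x = 1 / m x * (\<Sum>\<^sub>\<infinity>y\<in>V. w x y)"

definition Lip1 :: "('a \<Rightarrow> real) set" where
  "Lip1 = {f. \<forall>x\<in>V. \<forall>y\<in>V. \<bar>f x - f y\<bar> \<le> real (gdist x y)}"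

definition step_measure :: "real \<Rightarrow> 'a \<Rightarrow> 'a \<Rightarrow> real" where
  "step_measure \<epsilon> x y = (if y = x then 1 - \<epsilon> * Deg x else \<epsilon> * w x y / m x)"

text \<open>Measures are represented by their point masses. The supremum is over a set that is bounded
  above whenever \<open>\<mu>\<close> and \<open>\<nu>\<close> are finitely supported with equal total mass, so the
  real-valued \<open>SUP\<close> is meaningful.\<close>

definition wasserstein :: "('a \<Rightarrow> real) \<Rightarrow> ('a \<Rightarrow> real) \<Rightarrow> real" where
  "wasserstein \<mu> \<nu> = (SUP f\<in>{f \<in> Lip1. bounded (f ` V)}. \<Sum>\<^sub>\<infinity>x\<in>V. f x * (\<mu> x - \<nu> x))"

definition kappa_eps :: "real \<Rightarrow> 'a \<Rightarrow> 'a \<Rightarrow> real" where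
  "kappa_eps \<epsilon> x y =
     1 - wasserstein (step_measure \<epsilon> x) (step_measure \<epsilon> y) / real (gdist x y)"

definition kappa :: "'a \<Rightarrow> 'a \<Rightarrow> real" where
  "kappa x y = Lim (at_right 0) (\<lambda>\<epsilon>. 1 / \<epsilon> * kappa_eps \<epsilon> x y)"

definition Sph :: "'a \<Rightarrow> nat \<Rightarrow> 'a set" where
  "Sph x0 r = {y \<in> V. gdist x0 y = r}"

text \<open>Meaningful for \<open>r \<ge> 1\<close> with \<open>Sph x0 r \<noteq> {}\<close>; spheres are finite by local finiteness.\<close>

definition sphere_curv :: "'a \<Rightarrow> nat \<Rightarrow> real" where
  "sphere_curv x0 r =
     (MIN y\<in>Sph x0 r. MAX x\<in>{x \<in> Sph x0 (r - 1). (x, y) \<in> adj V w}. kappa x y)"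

definition Phi :: "'a \<Rightarrow> nat \<Rightarrow> real" where
  "Phi x0 R = Deg x0 - (\<Sum>r=1..R. sphere_curv x0 r)"

end

locale birth_death_chain = weighted_graph "UNIV :: nat set" w m
  for w :: "nat \<Rightarrow> nat \<Rightarrow> real" and m :: "nat \<Rightarrow> real" +
  assumes nearest_neighbour: "\<bar>int k - int n\<bar> \<noteq> 1 \<Longrightarrow> w k n = 0"

end

theory Submission imports Defs begin

text \<open>
  For adjacent vertices and any real-valued \<open>g\<close> one has
  \<open>\<Sum>z. g z * (m\<^sub>x\<^sup>\<epsilon> z - m\<^sub>y\<^sup>\<epsilon> z) = g x - g y + \<epsilon> * (\<Delta> g x - \<Delta> g y)\<close>, so \<open>\<kappa>\<^sub>\<epsilon>(x, y) / \<epsilon>\<close> is the infimum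
  over bounded \<open>g \<in> Lip(1)\<close> of \<open>(1 - (g x - g y)) / \<epsilon> + \<Delta> g y - \<Delta> g x\<close>. It is antitone in \<open>\<epsilon>\<close>, hence
  converges to its supremum \<open>\<kappa>(x, y)\<close>, and testing with \<open>g = - min f c\<close> for large \<open>c\<close> gives
  \<open>\<Delta> f y \<le> \<Delta> f x - \<kappa>(x, y)\<close> whenever \<open>f y = f x + 1\<close>. The claim follows by induction along a geodesic
  that picks the predecessor of maximal curvature. On a birth-death chain \<open>g = - f\<close> attains the
  infimum as soon as \<open>\<epsilon>\<close> is small, so every step is an equality.
\<close>

context weighted_graph
begin

section \<open>Neighbourhoods, distance and spheres\<close>

definition nbhd :: "'a \<Rightarrow> 'a set" where
  "nbhd x = {y \<in> V. w x y > 0}"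

definition Lip1_bdd :: "('a \<Rightarrow> real) set" where
  "Lip1_bdd = {f \<in> Lip1. bounded (f ` V)}"

lemma finite_nbhd: "x \<in> V \<Longrightarrow> finite (nbhd x)"
  unfolding nbhd_def by (rule locally_finite)

lemma nbhd_subset: "nbhd x \<subseteq> V"
  by (auto simp: nbhd_def)

lemma nbhd_iff_adj: "x \<in> V \<Longrightarrow> y \<in> nbhd x \<longleftrightarrow> (x, y) \<in> adj V w"
  by (auto simp: nbhd_def adj_def)

lemma w_eq_0: "x \<in> V \<Longrightarrow> y \<in> V \<Longrightarrow> y \<notin> nbhd x \<Longrightarrow> w x y = 0"
  using w_nonneg[of x y] by (auto simp: nbhd_def)

lemma adj_in_V: "(x, y) \<in> adj V w \<Longrightarrow> x \<in> V \<and> y \<in> V"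
  by (auto simp: adj_def)

lemma adj_neq: "(x, y) \<in> adj V w \<Longrightarrow> x \<noteq> y"
  using w_diag by (auto simp: adj_def)

lemma adj_sym: "(x, y) \<in> adj V w \<Longrightarrow> (y, x) \<in> adj V w"
  using w_sym by (auto simp: adj_def)

lemma relpow_gdist:
  assumes "x \<in> V" "y \<in> V"
  shows "(x, y) \<in> adj V w ^^ gdist x y"
proof -
  have "{n. (x, y) \<in> adj V w ^^ n} \<noteq> {}"
    using connected[OF assms] by (auto simp: rtrancl_power)
  from Inf_nat_def1[OF this] show ?thesis by (simp add: gdist_def)
qed

lemma gdist_le: "(x, y) \<in> adj V w ^^ n \<Longrightarrow> gdist x y \<le> n"
  unfolding gdist_def by (rule cInf_lower) auto

lemma gdist_self [simp]: "gdist x x = 0"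
  using gdist_le[of x x 0] by simp

lemma gdist_eq_0_iff: "x \<in> V \<Longrightarrow> y \<in> V \<Longrightarrow> gdist x y = 0 \<longleftrightarrow> x = y"
  using relpow_gdist[of x y] by auto

lemma gdist_triangle:
  assumes "x \<in> V" "y \<in> V" "z \<in> V"
  shows "gdist x z \<le> gdist x y + gdist y z"
  using relpow_gdist[of x y] relpow_gdist[of y z] assms
  by (intro gdist_le) (auto simp: relpow_add)

lemma relpow_adj_sym: "(x, y) \<in> adj V w ^^ n \<Longrightarrow> (y, x) \<in> adj V w ^^ n"
proof (induction n arbitrary: y)
  case (Suc n)
  then obtain z where "(x, z) \<in> adj V w ^^ n" "(z, y) \<in> adj V w" by auto
  then show ?case using Suc.IH[of z] adj_sym[of z y] by (blast intro: relpow_Suc_I2)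
qed simp

lemma gdist_sym: "x \<in> V \<Longrightarrow> y \<in> V \<Longrightarrow> gdist x y = gdist y x"
  by (rule order.antisym; rule gdist_le; rule relpow_adj_sym; rule relpow_gdist)

lemma gdist_adj:
  assumes "(x, y) \<in> adj V w"
  shows "gdist x y = 1"
proof -
  have "gdist x y \<le> 1" using gdist_le[of x y 1] assms by simp
  moreover have "gdist x y \<noteq> 0"
    using gdist_eq_0_iff[of x y] adj_in_V[OF assms] adj_neq[OF assms] by simp
  ultimately show ?thesis by simp
qed

text \<open>The vertex before \<open>y\<close> on a shortest walk from \<open>x0\<close>; the
  triangle inequality rules out that it is closer than \<open>r\<close>. It makes the inner maximum
  in \<open>sphere_curv\<close> range over a nonempty set.\<close>

lemma gdist_Suc_pred:
  assumes "x0 \<in> V" "y \<in> V" "gdist x0 y = Suc r"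
  obtains x where "x \<in> Sph x0 r" "(x, y) \<in> adj V w"
proof -
  obtain x where x: "(x0, x) \<in> adj V w ^^ r" "(x, y) \<in> adj V w"
    using relpow_gdist[OF assms(1,2)] assms(3) by (auto elim: relpow_Suc_E)
  have "x \<in> V" using x(2) adj_in_V by blast
  moreover have "gdist x0 x = r"
    using gdist_le[OF x(1)] gdist_triangle[of x0 x y] gdist_adj[OF x(2)] assms \<open>x \<in> V\<close> by simp
  ultimately show thesis using that x(2) by (auto simp: Sph_def)
qed

text \<open>Each sphere lies in the union of the neighbourhoods of the previous one. Finiteness is
  what gives \<open>Min\<close> and \<open>Max\<close> in \<open>sphere_curv\<close> their usual
  order properties.\<close>

lemma finite_Sph:
  assumes "x0 \<in> V"
  shows "finite (Sph x0 r)"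
proof (induction r)
  case 0
  have "Sph x0 0 \<subseteq> {x0}" using gdist_eq_0_iff assms by (auto simp: Sph_def)
  then show ?case by (rule finite_subset) simp
next
  case (Suc r)
  have "Sph x0 (Suc r) \<subseteq> (\<Union>x\<in>Sph x0 r. nbhd x)"
  proof
    fix y assume "y \<in> Sph x0 (Suc r)"
    then obtain x where "x \<in> Sph x0 r" "(x, y) \<in> adj V w"
      using gdist_Suc_pred[OF assms, of y r] by (auto simp: Sph_def)
    then show "y \<in> (\<Union>x\<in>Sph x0 r. nbhd x)"
      using nbhd_iff_adj[of x y] by (auto simp: Sph_def)
  qed
  moreover have "finite (\<Union>x\<in>Sph x0 r. nbhd x)"
    using Suc finite_nbhd by (auto simp: Sph_def)
  ultimately show ?case by (rule finite_subset)
qed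

section \<open>Laplacian and degree as finite sums\<close>

lemma infsum_w_eq_sum:
  assumes "x \<in> V" "finite F" "nbhd x \<subseteq> F" "F \<subseteq> V"
  shows "(\<Sum>\<^sub>\<infinity>y\<in>V. w x y * g y) = (\<Sum>y\<in>F. w x y * g y)"
proof -
  have "(\<Sum>\<^sub>\<infinity>y\<in>V. w x y * g y) = (\<Sum>\<^sub>\<infinity>y\<in>F. w x y * g y)"
    using assms w_eq_0[OF assms(1)] by (intro infsum_cong_neutral) auto
  then show ?thesis using assms(2) by simp
qed

lemma laplacian_eq_sum:
  assumes "x \<in> V" "finite F" "nbhd x \<subseteq> F" "F \<subseteq> V"
  shows "laplacian g x = (\<Sum>y\<in>F. w x y * (g y - g x)) / m x"
  using infsum_w_eq_sum[OF assms, of "\<lambda>y. g y - g x"] by (simp add: laplacian_def)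

lemma Deg_eq_sum:
  assumes "x \<in> V" "finite F" "nbhd x \<subseteq> F" "F \<subseteq> V"
  shows "Deg x = (\<Sum>y\<in>F. w x y) / m x"
  using infsum_w_eq_sum[OF assms, of "\<lambda>_. 1"] by (simp add: Deg_def)

text \<open>The Laplacian is local, so near a given vertex a truncated distance can stand in for the
  distance itself.\<close>

lemma laplacian_cong:
  assumes "x \<in> V" "g x = h x" "\<And>y. (x, y) \<in> adj V w \<Longrightarrow> g y = h y"
  shows "laplacian g x = laplacian h x"
  using assms nbhd_iff_adj[OF assms(1)]
  by (simp add: laplacian_eq_sum[OF assms(1) finite_nbhd[OF assms(1)] order_refl nbhd_subset])

lemma laplacian_uminus: "x \<in> V \<Longrightarrow> laplacian (\<lambda>z. - g z) x = - laplacian g x"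
  by (simp add: laplacian_eq_sum[OF _ finite_nbhd order_refl nbhd_subset] right_diff_distrib
      sum_subtractf minus_divide_left)

lemma abs_laplacian_le_Deg:
  assumes "g \<in> Lip1" "x \<in> V"
  shows "\<bar>laplacian g x\<bar> \<le> Deg x"
proof -
  have "\<bar>w x y * (g y - g x)\<bar> \<le> w x y" if "y \<in> nbhd x" for y
  proof -
    have "(y, x) \<in> adj V w"
      using that nbhd_iff_adj[OF assms(2)] by (blast intro: adj_sym)
    then have xy: "y \<in> V" "w x y > 0" "gdist y x = 1"
      using that by (auto simp: nbhd_def intro: gdist_adj[unfolded One_nat_def])
    have "\<bar>g y - g x\<bar> \<le> 1"
      using assms xy by (force simp: Lip1_def)
    then show ?thesis using xy(2) by (simp add: abs_mult mult_le_cancel_left1)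
  qed
  then have "\<bar>\<Sum>y\<in>nbhd x. w x y * (g y - g x)\<bar> \<le> (\<Sum>y\<in>nbhd x. w x y)"
    by (intro order_trans[OF sum_abs sum_mono])
  then show ?thesis using m_pos[OF assms(2)]
    by (simp add: laplacian_eq_sum[OF assms(2) finite_nbhd[OF assms(2)] order_refl nbhd_subset]
        Deg_eq_sum[OF assms(2) finite_nbhd[OF assms(2)] order_refl nbhd_subset] divide_right_mono)
qed

section \<open>Transport between step measures\<close>

lemma sum_step_measure:
  assumes "x \<in> V" "finite F" "nbhd x \<subseteq> F" "F \<subseteq> V" "x \<in> F"
  shows "(\<Sum>z\<in>F. g z * step_measure \<epsilon> x z) = g x + \<epsilon> * laplacian g x"
proof -
  \<comment> \<open>Since \<open>w x x = 0\<close>, the off-diagonal branch may be added at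
    \<open>z = x\<close> too. The identity is purely algebraic and does not ask that
    \<open>step_measure\<close> be nonnegative, so later arguments may use every positive
    \<open>\<epsilon>\<close>.\<close>
  have "g z * step_measure \<epsilon> x z
      = (if z = x then g x * (1 - \<epsilon> * Deg x) else 0) + \<epsilon> / m x * (w x z * g z)" for z
    using w_diag[OF assms(1)] by (auto simp: step_measure_def)
  then have "(\<Sum>z\<in>F. g z * step_measure \<epsilon> x z)
      = g x * (1 - \<epsilon> * Deg x) + \<epsilon> / m x * (\<Sum>z\<in>F. w x z * g z)"
    using assms by (simp add: sum.distrib sum_distrib_left sum.delta)
  moreover have "laplacian g x = (\<Sum>z\<in>F. w x z * g z) / m x - Deg x * g x"
    by (simp add: laplacian_eq_sum[OF assms(1-4)] Deg_eq_sum[OF assms(1-4)] algebra_simps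
        sum_subtractf sum_distrib_left diff_divide_distrib)
  ultimately show ?thesis by (simp add: right_diff_distrib)
qed

lemma infsum_step_measure_diff:
  assumes "x \<in> V" "y \<in> V"
  shows "(\<Sum>\<^sub>\<infinity>z\<in>V. g z * (step_measure \<epsilon> x z - step_measure \<epsilon> y z))
    = g x - g y + \<epsilon> * (laplacian g x - laplacian g y)"
proof -
  \<comment> \<open>A common finite set outside which both step measures vanish. The centres are
    inserted because a vertex is not in its own neighbourhood.\<close>
  define F where "F = insert x (nbhd x) \<union> insert y (nbhd y)"
  have F: "finite F" "nbhd x \<subseteq> F" "nbhd y \<subseteq> F" "F \<subseteq> V" "x \<in> F" "y \<in> F"
    using assms finite_nbhd nbhd_subset by (auto simp: F_def)
  have "(\<Sum>\<^sub>\<infinity>z\<in>V. g z * (step_measure \<epsilon> x z - step_measure \<epsilon> y z))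
      = (\<Sum>\<^sub>\<infinity>z\<in>F. g z * (step_measure \<epsilon> x z - step_measure \<epsilon> y z))"
    using F assms w_eq_0
    by (intro infsum_cong_neutral) (auto simp: step_measure_def F_def)
  also have "\<dots> = (\<Sum>z\<in>F. g z * step_measure \<epsilon> x z) - (\<Sum>z\<in>F. g z * step_measure \<epsilon> y z)"
    using F(1) by (simp add: right_diff_distrib sum_subtractf)
  also have "\<dots> = g x - g y + \<epsilon> * (laplacian g x - laplacian g y)"
    using F assms by (simp add: sum_step_measure algebra_simps)
  finally show ?thesis .
qed

text \<open>A concrete test function that drops by exactly 1 along every edge into \<open>y\<close>.
  It shows that suprema over \<open>Lip1_bdd\<close> are not empty and later bounds the curvature
  quotients uniformly in \<open>\<epsilon>\<close>.\<close>

lemma separating_Lip1_bdd: "(\<lambda>z. if z = y then 0 else 1) \<in> Lip1_bdd"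
proof -
  have "1 \<le> real (gdist a b)" if "a \<in> V" "b \<in> V" "a \<noteq> b" for a b
    using gdist_eq_0_iff[of a b] that by simp
  moreover have "bounded ((\<lambda>z. if z = y then 0 else 1 :: real) ` V)"
    by (rule bounded_subset[of "{0, 1}"]) auto
  ultimately show ?thesis
    by (auto simp: Lip1_bdd_def Lip1_def)
qed

lemma Lip1_bddD_adj:
  assumes "g \<in> Lip1_bdd" "(x, y) \<in> adj V w"
  shows "\<bar>g x - g y\<bar> \<le> 1"
  using assms gdist_adj[OF assms(2)] adj_in_V[OF assms(2)]
  by (force simp: Lip1_bdd_def Lip1_def)

lemma wasserstein_step_measure:
  assumes "x \<in> V" "y \<in> V"
  shows "wasserstein (step_measure \<epsilon> x) (step_measure \<epsilon> y)
    = (SUP g\<in>Lip1_bdd. g x - g y + \<epsilon> * (laplacian g x - laplacian g y))"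
  by (simp add: wasserstein_def infsum_step_measure_diff[OF assms] Lip1_bdd_def)

text \<open>A real-valued supremum is known to dominate its members only after such a bound. Along
  an edge, \<open>g\<close> drops by at most 1 and each Laplacian is controlled by the
  degree.\<close>

lemma bdd_above_transport:
  assumes "(x, y) \<in> adj V w" "\<epsilon> > 0"
  shows "bdd_above ((\<lambda>g. g x - g y + \<epsilon> * (laplacian g x - laplacian g y)) ` Lip1_bdd)"
proof (rule bdd_aboveI2)
  fix g assume g: "g \<in> Lip1_bdd"
  have "\<bar>laplacian g x\<bar> \<le> Deg x" "\<bar>laplacian g y\<bar> \<le> Deg y"
    using g adj_in_V[OF assms(1)] by (auto intro!: abs_laplacian_le_Deg simp: Lip1_bdd_def)
  then have "\<epsilon> * (laplacian g x - laplacian g y) \<le> \<epsilon> * (Deg x + Deg y)"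
    using assms(2) by (intro mult_left_mono) auto
  then show "g x - g y + \<epsilon> * (laplacian g x - laplacian g y) \<le> 1 + \<epsilon> * (Deg x + Deg y)"
    using Lip1_bddD_adj[OF g assms(1)] by linarith
qed

section \<open>Curvature along an edge\<close>

lemma kappa_eps_le:
  assumes "(x, y) \<in> adj V w" "\<epsilon> > 0" "g \<in> Lip1_bdd"
  shows "1 / \<epsilon> * kappa_eps \<epsilon> x y \<le> (1 - (g x - g y)) / \<epsilon> + laplacian g y - laplacian g x"
proof -
  have xy: "x \<in> V" "y \<in> V" using adj_in_V[OF assms(1)] by auto
  have "g x - g y + \<epsilon> * (laplacian g x - laplacian g y)
      \<le> wasserstein (step_measure \<epsilon> x) (step_measure \<epsilon> y)"
    unfolding wasserstein_step_measure[OF xy]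
    by (rule cSUP_upper[OF assms(3) bdd_above_transport[OF assms(1,2)]])
  then have "1 / \<epsilon> * kappa_eps \<epsilon> x y
      \<le> 1 / \<epsilon> * (1 - (g x - g y + \<epsilon> * (laplacian g x - laplacian g y)))"
    using assms(2) gdist_adj[OF assms(1)] by (intro mult_left_mono) (auto simp: kappa_eps_def)
  also have "\<dots> = (1 - (g x - g y)) / \<epsilon> + laplacian g y - laplacian g x"
    using assms(2) by (simp add: field_simps)
  finally show ?thesis .
qed

text \<open>Together with \<open>kappa_eps_le\<close>, this identifies the quotient as the greatest
  lower bound over test functions. The distance in the denominator is 1 along an edge.\<close>

lemma kappa_eps_ge:
  assumes "(x, y) \<in> adj V w" "\<epsilon> > 0"
    and "\<And>g. g \<in> Lip1_bdd \<Longrightarrow> K \<le> (1 - (g x - g y)) / \<epsilon> + laplacian g y - laplacian g x"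
  shows "K \<le> 1 / \<epsilon> * kappa_eps \<epsilon> x y"
proof -
  have xy: "x \<in> V" "y \<in> V" using adj_in_V[OF assms(1)] by auto
  have "wasserstein (step_measure \<epsilon> x) (step_measure \<epsilon> y) \<le> 1 - \<epsilon> * K"
    unfolding wasserstein_step_measure[OF xy]
  proof (rule cSUP_least)
    show "Lip1_bdd \<noteq> {}" using separating_Lip1_bdd by blast
    fix g assume "g \<in> Lip1_bdd"
    from assms(3)[OF this] show "g x - g y + \<epsilon> * (laplacian g x - laplacian g y) \<le> 1 - \<epsilon> * K"
      using assms(2) by (simp add: field_simps)
  qed
  then show ?thesis using assms(2) gdist_adj[OF assms(1)]
    by (simp add: kappa_eps_def field_simps)
qed

text \<open>In the bound for a fixed \<open>g\<close>, only the deficit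
  \<open>1 - (g x - g y)\<close> is divided by \<open>\<epsilon>\<close>, and it is nonnegative by
  the Lipschitz condition.\<close>

lemma kappa_eps_antimono:
  assumes "(x, y) \<in> adj V w" "0 < \<epsilon>" "\<epsilon> \<le> \<delta>"
  shows "1 / \<delta> * kappa_eps \<delta> x y \<le> 1 / \<epsilon> * kappa_eps \<epsilon> x y"
proof (rule kappa_eps_ge[OF assms(1,2)])
  fix g assume g: "g \<in> Lip1_bdd"
  have "(1 - (g x - g y)) / \<delta> \<le> (1 - (g x - g y)) / \<epsilon>"
    using assms Lip1_bddD_adj[OF g assms(1)] by (intro divide_left_mono) auto
  then show "1 / \<delta> * kappa_eps \<delta> x y \<le> (1 - (g x - g y)) / \<epsilon> + laplacian g y - laplacian g x"
    using kappa_eps_le[OF assms(1) _ g, of \<delta>] assms by simp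
qed

lemma kappa_eps_bdd_above:
  assumes "(x, y) \<in> adj V w"
  shows "bdd_above ((\<lambda>\<epsilon>. 1 / \<epsilon> * kappa_eps \<epsilon> x y) ` {0<..})"
proof -
  let ?h = "\<lambda>z. if z = y then 0 else 1 :: real"
  have "1 / \<epsilon> * kappa_eps \<epsilon> x y \<le> laplacian ?h y - laplacian ?h x" if "\<epsilon> \<in> {0<..}" for \<epsilon>
    using kappa_eps_le[OF assms _ separating_Lip1_bdd, of \<epsilon> y] that adj_neq[OF assms] by simp
  then show ?thesis by (rule bdd_aboveI2)
qed

text \<open>\<open>kappa\<close> is defined by \<open>Lim\<close>, which is informative only once
  convergence is proved. Here it follows from monotonicity and boundedness.\<close>

lemma kappa_eq_SUP:
  assumes "(x, y) \<in> adj V w"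
  shows "kappa x y = (SUP \<epsilon>\<in>{0<..}. 1 / \<epsilon> * kappa_eps \<epsilon> x y)"
proof -
  let ?q = "\<lambda>\<epsilon>. 1 / \<epsilon> * kappa_eps \<epsilon> x y"
  have "(?q \<longlongrightarrow> (SUP \<epsilon>\<in>{0<..}. ?q \<epsilon>)) (at_right 0)"
  proof (rule increasing_tendsto)
    show "\<forall>\<^sub>F \<epsilon> in at_right 0. ?q \<epsilon> \<le> (SUP \<epsilon>\<in>{0<..}. ?q \<epsilon>)"
      using eventually_at_right_less[of 0]
      by eventually_elim (rule cSUP_upper[OF _ kappa_eps_bdd_above[OF assms]], simp)
    fix u assume "u < (SUP \<epsilon>\<in>{0<..}. ?q \<epsilon>)"
    then obtain \<delta> where \<delta>: "\<delta> > 0" "u < ?q \<delta>"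
      using less_cSUP_iff[OF _ kappa_eps_bdd_above[OF assms], of u] by auto
    have "\<forall>\<^sub>F \<epsilon> in at_right 0. \<epsilon> \<in> {0<..<\<delta>}"
      using \<delta>(1) by (rule eventually_at_right_real)
    then show "\<forall>\<^sub>F \<epsilon> in at_right 0. u < ?q \<epsilon>"
    proof eventually_elim
      case (elim \<epsilon>)
      then show ?case using kappa_eps_antimono[OF assms, of \<epsilon> \<delta>] \<delta>(2) by simp
    qed
  qed
  then show ?thesis unfolding kappa_def by (intro tendsto_Lim) auto
qed

text \<open>With zero deficit the bound on the quotient no longer depends on
  \<open>\<epsilon>\<close>, so it passes to the supremum.\<close>

lemma kappa_le:
  assumes "(x, y) \<in> adj V w" "g \<in> Lip1_bdd" "g x - g y = 1"
  shows "kappa x y \<le> laplacian g y - laplacian g x"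
  unfolding kappa_eq_SUP[OF assms(1)]
  using kappa_eps_le[OF assms(1) _ assms(2)] assms(3) by (intro cSUP_least) auto

text \<open>As \<open>kappa\<close> is a supremum, a single \<open>\<epsilon>\<close> suffices for a
  lower bound.\<close>

lemma kappa_ge:
  assumes "(x, y) \<in> adj V w" "\<epsilon> > 0"
    and "\<And>g. g \<in> Lip1_bdd \<Longrightarrow> K \<le> (1 - (g x - g y)) / \<epsilon> + laplacian g y - laplacian g x"
  shows "K \<le> kappa x y"
proof -
  have "1 / \<epsilon> * kappa_eps \<epsilon> x y \<le> kappa x y"
    unfolding kappa_eq_SUP[OF assms(1)]
    using assms(2) by (intro cSUP_upper[OF _ kappa_eps_bdd_above[OF assms(1)]]) simp
  then show ?thesis using kappa_eps_ge[OF assms] by simp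
qed

section \<open>Laplacian comparison for the distance function\<close>

lemma truncated_gdist_Lip1_bdd:
  assumes "x0 \<in> V"
  shows "(\<lambda>z. - real (min (gdist x0 z) n)) \<in> Lip1_bdd"
proof -
  have "\<bar>- real (min (gdist x0 a) n) - - real (min (gdist x0 b) n)\<bar> \<le> real (gdist a b)"
    if "a \<in> V" "b \<in> V" for a b
    using gdist_triangle[of x0 a b] gdist_triangle[of x0 b a] gdist_sym[of a b] that assms
    by auto
  moreover have "bounded ((\<lambda>z. - real (min (gdist x0 z) n)) ` V)"
    by (rule boundedI[of _ "real n"]) auto
  ultimately show ?thesis by (auto simp: Lip1_bdd_def Lip1_def)
qed

lemma kappa_le_laplacian_gdist:
  assumes "x0 \<in> V" "(x, y) \<in> adj V w" "gdist x0 y = Suc (gdist x0 x)"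
  shows "kappa x y \<le> laplacian (\<lambda>z. real (gdist x0 z)) x - laplacian (\<lambda>z. real (gdist x0 z)) y"
proof -
  \<comment> \<open>Every neighbour of \<open>x\<close> or \<open>y\<close> is at distance at most
    \<open>n\<close> from \<open>x0\<close>, so truncating at \<open>n\<close> changes neither
    Laplacian but makes the test function bounded. The minus sign in \<open>g\<close> makes it drop
    by 1 from \<open>x\<close> to \<open>y\<close>.\<close>
  define n where "n = Suc (gdist x0 y)"
  define g where "g = (\<lambda>z. - real (min (gdist x0 z) n))"
  have xy: "x \<in> V" "y \<in> V" using adj_in_V[OF assms(2)] by auto
  have "laplacian g a = - laplacian (\<lambda>z. real (gdist x0 z)) a" if "a \<in> V" "gdist x0 a < n" for a
  proof -
    have "laplacian g a = laplacian (\<lambda>z. - real (gdist x0 z)) a"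
    proof (rule laplacian_cong[OF that(1)])
      show "g a = - real (gdist x0 a)" using that by (simp add: g_def)
      fix b assume "(a, b) \<in> adj V w"
      then have "gdist x0 b \<le> n"
        using gdist_triangle[of x0 a b] gdist_adj[of a b] adj_in_V[of a b] assms(1) that by simp
      then show "g b = - real (gdist x0 b)" by (simp add: g_def)
    qed
    then show ?thesis using laplacian_uminus[OF that(1)] by simp
  qed
  moreover have "kappa x y \<le> laplacian g y - laplacian g x"
  proof (rule kappa_le[OF assms(2)])
    show "g \<in> Lip1_bdd" unfolding g_def using assms(1) by (rule truncated_gdist_Lip1_bdd)
    show "g x - g y = 1" using assms(3) by (simp add: g_def n_def)
  qed
  ultimately show ?thesis using xy assms(3) by (simp add: n_def)
qed

lemma laplacian_gdist_root:
  assumes "x0 \<in> V"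
  shows "laplacian (\<lambda>z. real (gdist x0 z)) x0 = Deg x0"
proof -
  have "w x0 y * (real (gdist x0 y) - real (gdist x0 x0)) = w x0 y" if "y \<in> nbhd x0" for y
  proof -
    have "(x0, y) \<in> adj V w" using that nbhd_iff_adj[OF assms, of y] by blast
    then show ?thesis using gdist_adj[of x0 y] by simp
  qed
  then have "(\<Sum>y\<in>nbhd x0. w x0 y * (real (gdist x0 y) - real (gdist x0 x0)))
      = (\<Sum>y\<in>nbhd x0. w x0 y)"
    by (intro sum.cong) auto
  then show ?thesis
    by (simp only: laplacian_eq_sum[OF assms finite_nbhd[OF assms] order_refl nbhd_subset]
        Deg_eq_sum[OF assms finite_nbhd[OF assms] order_refl nbhd_subset])
qed

lemma laplacian_gdist_le_Phi:
  assumes "x0 \<in> V" "y \<in> V"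
  shows "laplacian (\<lambda>z. real (gdist x0 z)) y \<le> Phi x0 (gdist x0 y)"
  using assms(2)
proof (induction "gdist x0 y" arbitrary: y)
  case 0
  then show ?case
    using gdist_eq_0_iff[of x0 y] laplacian_gdist_root[OF assms(1)] assms(1) by (simp add: Phi_def)
next
  case (Suc r)
  define P where "P = (\<lambda>y. {x \<in> Sph x0 r. (x, y) \<in> adj V w})"
  have fin: "finite (P y)" using finite_Sph[OF assms(1)] by (simp add: P_def)
  have ne: "P y \<noteq> {}"
    using gdist_Suc_pred[OF assms(1) Suc.prems, of r] Suc.hyps(2) by (auto simp: P_def)
  \<comment> \<open>Choose the predecessor \<open>x\<close> where the maximum is attained; the
    curvature at another predecessor may lie below \<open>sphere_curv\<close>.\<close>
  have "(MAX x\<in>P y. kappa x y) \<in> (\<lambda>x. kappa x y) ` P y"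
    using fin ne by (intro Max_in) auto
  then obtain x where x: "x \<in> P y" "(MAX x\<in>P y. kappa x y) = kappa x y" by auto
  have "y \<in> Sph x0 (Suc r)" using Suc by (simp add: Sph_def)
  then have "sphere_curv x0 (Suc r) \<le> kappa x y"
    unfolding sphere_curv_def x(2)[symmetric] P_def
    using finite_Sph[OF assms(1)] by (auto intro!: Min_le)
  moreover have "x \<in> V" "gdist x0 x = r" "(x, y) \<in> adj V w"
    using x(1) by (auto simp: P_def Sph_def)
  moreover have "laplacian (\<lambda>z. real (gdist x0 z)) x \<le> Phi x0 r"
    using Suc.hyps(1)[of x] calculation by simp
  moreover have "Phi x0 (Suc r) = Phi x0 r - sphere_curv x0 (Suc r)"
    by (simp add: Phi_def)
  ultimately show ?case
    using kappa_le_laplacian_gdist[OF assms(1), of x y] Suc.hyps(2) by simp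
qed

end

section \<open>Equality on birth-death chains\<close>

context birth_death_chain
begin

lemma adjD: "(k, n) \<in> adj UNIV w \<Longrightarrow> n = Suc k \<or> k = Suc n"
proof -
  assume "(k, n) \<in> adj UNIV w"
  then have "w k n \<noteq> 0" by (simp add: adj_def)
  then have "\<bar>int k - int n\<bar> = 1" using nearest_neighbour by blast
  then show "n = Suc k \<or> k = Suc n" by linarith
qed

text \<open>A walk from 0 to a vertex beyond \<open>r\<close> has to traverse the edge from \<open>r\<close> to \<open>r + 1\<close>.\<close>

lemma adj_Suc: "(r, Suc r) \<in> adj UNIV w"
proof -
  have "(r, Suc r) \<in> adj UNIV w" if "(0, z) \<in> (adj UNIV w)\<^sup>*" "Suc r \<le> z" for z
    using that
  proof (induction rule: rtrancl_induct)
    case (step y z)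
    then show ?case
    proof (cases "Suc r \<le> y")
      case False
      then have "y = r" "z = Suc r" using adjD[OF step(2)] step(4) by auto
      then show ?thesis using step(2) by simp
    qed simp
  qed simp
  then show ?thesis using connected[of 0 "Suc r"] by simp
qed

lemma gdist_0: "gdist 0 r = r"
proof (rule order.antisym)
  have "(0, r) \<in> adj UNIV w ^^ r"
    using adj_Suc by (induction r) auto
  then show "gdist 0 r \<le> r" by (rule gdist_le)
  have "z \<le> n" if "(0, z) \<in> adj UNIV w ^^ n" for z n
    using that
  proof (induction n arbitrary: z)
    case (Suc n)
    then obtain y where "(0, y) \<in> adj UNIV w ^^ n" "(y, z) \<in> adj UNIV w" by auto
    then show ?case using Suc.IH[of y] adjD[of y z] by auto
  qed simp
  then show "r \<le> gdist 0 r" using relpow_gdist[of 0 r] by simp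
qed

lemma laplacian_Suc:
  "laplacian g (Suc r) =
    (w (Suc r) r * (g r - g (Suc r)) + w (Suc r) (Suc (Suc r)) * (g (Suc (Suc r)) - g (Suc r)))
    / m (Suc r)"
proof -
  have "nbhd (Suc r) \<subseteq> {r, Suc (Suc r)}"
    using adjD[of "Suc r"] nbhd_iff_adj[of "Suc r"] by auto
  then show ?thesis by (subst laplacian_eq_sum[of _ "{r, Suc (Suc r)}"]) auto
qed

lemma laplacian_0: "laplacian g 0 = w 0 1 * (g 1 - g 0) / m 0"
proof -
  have "nbhd 0 \<subseteq> {1}"
    using adjD[of 0] nbhd_iff_adj[of 0] by auto
  then show ?thesis by (subst laplacian_eq_sum[of _ "{1}"]) auto
qed

text \<open>Comparison with \<open>- real\<close>, the expected optimiser. The edge to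
  \<open>Suc r\<close> contributes the deficit term exactly; on the edge below \<open>r\<close>, if
  any, a gain of at most 1 is just the Lipschitz bound.\<close>

lemma laplacian_le_upward:
  assumes "g \<in> Lip1_bdd"
  shows "laplacian g r \<le> - laplacian real r + (1 - (g r - g (Suc r))) * (w r (Suc r) / m r)"
proof (cases r)
  case 0
  then show ?thesis
    using m_pos[of 0] by (simp add: laplacian_0 field_simps)
next
  case (Suc k)
  have "g k - g (Suc k) \<le> 1" using Lip1_bddD_adj[OF assms adj_Suc[of k]] by simp
  then have "w (Suc k) k * (g k - g (Suc k)) \<le> w (Suc k) k"
    using w_nonneg[of "Suc k" k] by (simp add: mult_left_le)
  then have "w (Suc k) k * (g k - g (Suc k)) / m (Suc k) \<le> w (Suc k) k / m (Suc k)"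
    using m_pos[of "Suc k"] by (intro divide_right_mono) auto
  then show ?thesis
    unfolding Suc laplacian_Suc by (simp add: algebra_simps add_divide_distrib diff_divide_distrib)
qed

text \<open>The mirror estimate: the edge back to \<open>r\<close> is exact, and towards
  \<open>Suc (Suc r)\<close> the function \<open>g\<close> falls by at most 1.\<close>

lemma laplacian_ge_downward:
  assumes "g \<in> Lip1_bdd"
  shows "- laplacian real (Suc r) - (1 - (g r - g (Suc r))) * (w (Suc r) r / m (Suc r))
    \<le> laplacian g (Suc r)"
proof -
  have "- 1 \<le> g (Suc (Suc r)) - g (Suc r)"
    using Lip1_bddD_adj[OF assms adj_Suc[of "Suc r"]] by simp
  then have "w (Suc r) (Suc (Suc r)) * (- 1)
      \<le> w (Suc r) (Suc (Suc r)) * (g (Suc (Suc r)) - g (Suc r))"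
    using w_nonneg by (intro mult_left_mono) auto
  then have "w (Suc r) (Suc (Suc r)) * (- 1) / m (Suc r)
      \<le> w (Suc r) (Suc (Suc r)) * (g (Suc (Suc r)) - g (Suc r)) / m (Suc r)"
    using m_pos[of "Suc r"] by (intro divide_right_mono) auto
  then show ?thesis
    unfolding laplacian_Suc by (simp add: algebra_simps add_divide_distrib diff_divide_distrib)
qed

lemma kappa_Suc: "kappa r (Suc r) = laplacian real r - laplacian real (Suc r)"
proof (rule order.antisym)
  show "kappa r (Suc r) \<le> laplacian real r - laplacian real (Suc r)"
    using kappa_le_laplacian_gdist[of 0 r "Suc r"] adj_Suc by (simp add: gdist_0)
  \<comment> \<open>\<open>C\<close> is the total coefficient of the deficit in the upward and
    downward estimates. At \<open>\<epsilon> = 1 / C\<close> the penalty for the deficit is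
    \<open>C\<close> times the deficit and compensates both error terms.\<close>
  define C where "C = w r (Suc r) / m r + w (Suc r) r / m (Suc r)"
  have "C > 0"
    using adj_Suc[of r] adj_sym[OF adj_Suc[of r]] m_pos
    by (auto simp: C_def adj_def intro!: add_pos_pos divide_pos_pos)
  show "laplacian real r - laplacian real (Suc r) \<le> kappa r (Suc r)"
  proof (rule kappa_ge[OF adj_Suc, of "1 / C"])
    show "1 / C > 0" using \<open>C > 0\<close> by simp
    fix g assume "g \<in> Lip1_bdd"
    from laplacian_le_upward[OF this, of r] laplacian_ge_downward[OF this, of r]
    show "laplacian real r - laplacian real (Suc r)
        \<le> (1 - (g r - g (Suc r))) / (1 / C) + laplacian g (Suc r) - laplacian g r"
      by (simp add: C_def distrib_left)
  qed
qed

text \<open>Each sphere is one vertex with one predecessor, so passing to the minimum and maximum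
  loses nothing.\<close>

lemma sphere_curv_Suc: "sphere_curv 0 (Suc r) = kappa r (Suc r)"
proof -
  have "Sph 0 n = {n}" for n by (auto simp: Sph_def gdist_0)
  moreover have "{x \<in> {r}. (x, Suc r) \<in> adj UNIV w} = {r}" using adj_Suc by auto
  ultimately show ?thesis by (simp add: sphere_curv_def)
qed

text \<open>The equalities from \<open>kappa_Suc\<close> telescope, starting from the value
  \<open>Deg 0\<close> at the root.\<close>

lemma laplacian_eq_Phi: "laplacian real r = Phi 0 r"
proof (induction r)
  case 0
  then show ?case using laplacian_gdist_root[of 0] by (simp add: gdist_0 Phi_def)
next
  case (Suc r)
  then show ?case using kappa_Suc[of r] by (simp add: Phi_def sphere_curv_Suc)
qed

end

theorem theorem4p4:
  "(\<forall>(V :: 'a set) w m x0. weighted_graph V w m \<and> x0 \<in> V \<longrightarrow>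
      (\<forall>x\<in>V. weighted_graph.laplacian V w m (\<lambda>y. real (weighted_graph.gdist V w x0 y)) x
        \<le> weighted_graph.Phi V w m x0 (weighted_graph.gdist V w x0 x))) \<and>
   (\<forall>(w :: nat \<Rightarrow> nat \<Rightarrow> real) m. birth_death_chain w m \<longrightarrow>
      (\<forall>r. weighted_graph.gdist UNIV w 0 r = r \<and>
        weighted_graph.laplacian UNIV w m (\<lambda>y. real (weighted_graph.gdist UNIV w 0 y)) r
        = weighted_graph.Phi UNIV w m 0 (weighted_graph.gdist UNIV w 0 r)))"
proof (intro conjI allI impI ballI)
  fix V :: "'a set" and w m x0 x
  assume "weighted_graph V w m \<and> x0 \<in> V" "x \<in> V"
  then show "weighted_graph.laplacian V w m (\<lambda>y. real (weighted_graph.gdist V w x0 y)) x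
      \<le> weighted_graph.Phi V w m x0 (weighted_graph.gdist V w x0 x)"
    using weighted_graph.laplacian_gdist_le_Phi[of V w m x0 x] by simp
next
  fix w :: "nat \<Rightarrow> nat \<Rightarrow> real" and m r
  assume "birth_death_chain w m"
  then interpret birth_death_chain w m .
  show "gdist 0 r = r" by (rule gdist_0)
  show "laplacian (\<lambda>y. real (gdist 0 y)) r = Phi 0 (gdist 0 r)"
    by (simp add: gdist_0 laplacian_eq_Phi)
qed

end
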